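(* Let $\lambda^{*}$ be the optimal Lagrange multiplier of the problem QCQP defined in the context, and let $\hat\lambda\ge 0$ satisfy $A+\hat\lambda B\succ 0$. (1) Suppose $\phi(\hat\lambda)>0$ and $\lambda^{*}\in(\hat\lambda,\bar\lambda]$, that $\bar\lambda$ is finite, and that $a+\bar\lambda b\in\text{Range}(A+\bar\lambda B)$. Let $v_1,\dots,v_r$ be an orthonormal basis of $\text{Null}(A+\bar\lambda B)$, $Z=[v_1,\dots,v_r]$, $x(\bar\lambda)=-(A+\bar\lambda B)^{\dagger}(a+\bar\lambda b)$, and $$p^{*}=\max_{y\in\mathbb{R}^r} g(x(\bar\lambda)+Zy).$$ Then $\lambda^{*}=\bar\lambda$ if and only if $p^{*}\ge 0$. (2) Suppose $\phi(\hat\lambda)<0$ and $\lambda^{*}\in[\underline\lambda,\hat\lambda)$, that $\underline\lambda$ is finite with $\underline\lambda\ge 0$, and that $a+\underline\lambda b\in\text{Range}(A+\underline\lambda B)$. Let $v_1,\dots,v_r$ be an orthonormal basis of $\text{Null}(A+\underline\lambda B)$, $Z=[v_1,\dots,v_r]$, $x(\underline\lambda)=-(A+\underline\lambda B)^{\dagger}(a+\underline\lambda b)$, and $$p^{*}=\min_{y\in\mathbb{R}^r} g(x(\underline\lambda)+Zy).$$ Then $\lambda^{*}=\underline\lambda$ if and only if $p^{*}\le 0$.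
   Context: $A,B\in\mathbb{R}^{n\times n}$ are symmetric (no definiteness assumed), $a,b\in\mathbb{R}^n$, $\beta\in\mathbb{R}$. QCQP is the problem of minimizing $q(x)=x^TAx+2a^Tx$ over $x\in\mathbb{R}^n$ subject to $g(x)=x^TBx+2b^Tx+\beta\le 0$. Standing assumptions: (Assumption 1) there is $\hat x$ with $g(\hat x)<0$; (Assumption 2) there is $\hat\lambda\ge 0$ with $A+\hat\lambda B\succ 0$. An optimal Lagrange multiplier is a number $\lambda^{*}\ge 0$ for which there is $x^{*}\in\mathbb{R}^n$ with $(A+\lambda^{*}B)x^{*}=-(a+\lambda^{*}b)$, $g(x^{*})\le 0$, $\lambda^{*}g(x^{*})=0$ and $A+\lambda^{*}B\succeq 0$ (under Assumption 1, $x^*$ is a global optimal solution of QCQP if and only if such a $\lambda^*$ exists for it). By Assumption 2, the set of real $\lambda$ with $A+\lambda B\succeq 0$ is a closed interval with (possibly infinite) endpoints $\underline\lambda<\bar\lambda$: for real $\lambda$, $A+\lambda B\succeq0$ iff $\underline\lambda\le\lambda\le\bar\lambda$. For $\lambda\in(\underline\lambda,\bar\lambda)$ put $x(\lambda)=-(A+\lambda B)^{-1}(a+\lambda b)$ and $\phi(\lambda)=g(x(\lambda))=x(\lambda)^TBx(\lambda)+2b^Tx(\lambda)+\beta$. $M^{\dagger}$ denotes the Moore-Penrose generalized inverse; $\succ0$ and $\succeq0$ denote positive definite and positive semidefinite. *)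

theory Defs
  imports "HOL-Analysis.Analysis"
begin

section \<open>Definite matrices and the Moore-Penrose inverse\<close>

definition pos_def :: "real^'n^'n \<Rightarrow> bool" where
  "pos_def M \<longleftrightarrow> transpose M = M \<and> (\<forall>x. x \<noteq> 0 \<longrightarrow> x \<bullet> (M *v x) > 0)"

definition pos_semidef :: "real^'n^'n \<Rightarrow> bool" where
  "pos_semidef M \<longleftrightarrow> transpose M = M \<and> (\<forall>x. x \<bullet> (M *v x) \<ge> 0)"

text \<open>The four Penrose equations; \<open>ex1_moore_penrose\<close> below shows that they determine
  \<open>X\<close> uniquely, so the definite description in \<open>pinv\<close> is well-defined.\<close>

definition moore_penrose :: "real^'m^'n \<Rightarrow> real^'n^'m \<Rightarrow> bool" where
  "moore_penrose M X \<longleftrightarrow>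
     M ** X ** M = M \<and> X ** M ** X = X \<and>
     transpose (M ** X) = M ** X \<and> transpose (X ** M) = X ** M"

definition pinv :: "real^'m^'n \<Rightarrow> real^'n^'m" where
  "pinv M = (THE X. moore_penrose M X)"

lemma inner_transpose_matrix:
  fixes M :: "real^'m^'n"
  shows "(transpose M *v x) \<bullet> y = x \<bullet> (M *v y)"
  by (simp only: transpose_matrix_vector dot_lmul_matrix)

lemma symmetric_matrixI:
  fixes M :: "real^'n^'n"
  assumes "\<And>x y. (M *v x) \<bullet> y = x \<bullet> (M *v y)"
  shows "transpose M = M"
proof -
  have "transpose M *v x = M *v x" for x
  proof -
    have "(transpose M *v x) \<bullet> y = (M *v x) \<bullet> y" for y
      by (simp only: assms inner_transpose_matrix)
    then show ?thesis
      using vector_eq_rdot by blast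
  qed
  then show ?thesis
    by (simp add: matrix_eq)
qed

lemma moore_penrose_unique:
  assumes "moore_penrose M X" "moore_penrose M Y"
  shows "X = Y"
proof -
  have X: "M ** X ** M = M" "X ** M ** X = X" "transpose (M ** X) = M ** X" "transpose (X ** M) = X ** M"
    and Y: "M ** Y ** M = M" "Y ** M ** Y = Y" "transpose (M ** Y) = M ** Y" "transpose (Y ** M) = Y ** M"
    using assms unfolding moore_penrose_def by auto
  have "M ** X = transpose (M ** Y ** M ** X)"
    using X Y by simp
  also have "\<dots> = transpose (M ** X) ** transpose (M ** Y)"
    by (metis matrix_transpose_mul matrix_mul_assoc)
  also have "\<dots> = M ** Y"
    using X(1,3) Y(3) by (simp add: matrix_mul_assoc)
  finally have MX: "M ** X = M ** Y" .
  have "X ** M = transpose (X ** M ** Y ** M)"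
    using X Y by (metis matrix_mul_assoc)
  also have "\<dots> = transpose (Y ** M) ** transpose (X ** M)"
    by (metis matrix_transpose_mul matrix_mul_assoc)
  also have "\<dots> = Y ** M"
    using X(1,4) Y(4) by (metis matrix_mul_assoc)
  finally have XM: "X ** M = Y ** M" .
  have "X = X ** (M ** X)"
    using X(2) by (simp add: matrix_mul_assoc)
  also have "\<dots> = Y ** (M ** Y)"
    by (metis MX XM matrix_mul_assoc)
  also have "\<dots> = Y"
    using Y(2) by (simp add: matrix_mul_assoc)
  finally show ?thesis .
qed

lemma moore_penrose_exists:
  fixes M :: "real^'m^'n"
  shows "\<exists>X. moore_penrose M X"
proof -
  define P where "P b x \<longleftrightarrow>
    (\<forall>z. M *v z = 0 \<longrightarrow> x \<bullet> z = 0) \<and> (\<forall>w. (b - M *v x) \<bullet> (M *v w) = 0)"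
    for b :: "real^'n" and x :: "real^'m"
  have subN: "subspace {z. M *v z = 0}"
    by (auto simp: subspace_def matrix_vector_right_distrib matrix_vector_mult_scaleR)
  have subR: "subspace (range ((*v) M))"
    by (simp add: linear_subspace_image)
  have ex: "\<exists>x. P b x" for b
  proof -
    obtain u w where u: "u \<in> span (range ((*v) M))"
      and w: "\<And>t. t \<in> span (range ((*v) M)) \<Longrightarrow> orthogonal w t" and b: "b = u + w"
      using orthogonal_subspace_decomp_exists by metis
    have "span (range ((*v) M)) = range ((*v) M)"
      using subR by (simp add: span_eq_iff)
    then obtain s where s: "u = M *v s"
      using u by (metis imageE)
    obtain p q where p: "p \<in> span {z. M *v z = 0}"
      and q: "\<And>t. t \<in> span {z. M *v z = 0} \<Longrightarrow> orthogonal q t" and spq: "s = p + q"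
      using orthogonal_subspace_decomp_exists by metis
    have "M *v p = 0"
      using p subN by (metis (mono_tags, lifting) mem_Collect_eq span_eq_iff)
    then have "M *v q = u"
      by (simp add: s spq matrix_vector_right_distrib)
    then have "P b q"
      using q w b by (auto simp: P_def orthogonal_def span_base)
    then show ?thesis ..
  qed
  have uniq: "x = y" if "P b x" "P b y" for b x y
  proof -
    have d: "M *v (x - y) = (b - M *v y) - (b - M *v x)"
      by (simp add: matrix_vector_mult_diff_distrib)
    have "(M *v (x - y)) \<bullet> (M *v (x - y)) = 0"
      using that by (subst (1) d) (simp add: P_def inner_diff_left)
    then have 0: "M *v (x - y) = 0"
      by simp
    then have "(x - y) \<bullet> (x - y) = 0"
      using that by (subst (1) inner_diff_left) (simp add: P_def)
    then show ?thesis
      by simp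
  qed
  define f where "f b = (SOME x. P b x)" for b
  have f: "P b (f b)" for b
    unfolding f_def by (rule someI_ex[OF ex])
  have lin: "linear f"
  proof (rule linearI)
    fix b c :: "real^'n" and r :: real
    have "P (b + c) (f b + f c)"
      using f[of b] f[of c]
      by (simp add: P_def matrix_vector_right_distrib inner_add_left inner_diff_left algebra_simps)
    then show "f (b + c) = f b + f c"
      using f uniq by blast
    have "(r *\<^sub>R b - r *\<^sub>R (M *v f b)) \<bullet> (M *v w) = 0" for w
      using f[of b] by (simp add: P_def flip: scaleR_right_diff_distrib)
    then have "P (r *\<^sub>R b) (r *\<^sub>R f b)"
      using f[of b] by (simp add: P_def matrix_vector_mult_scaleR)
    then show "f (r *\<^sub>R b) = r *\<^sub>R f b"
      using f uniq by blast
  qed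
  define X where "X = matrix f"
  have X: "X *v b = f b" for b
    unfolding X_def using lin by (simp add: matrix_works)
  have MXM: "M *v (X *v (M *v x)) = M *v x" for x
  proof -
    have "(M *v x - M *v f (M *v x)) \<bullet> (M *v (x - f (M *v x))) = 0"
      using f[of "M *v x"] unfolding P_def by blast
    then show ?thesis
      by (simp add: X matrix_vector_mult_diff_distrib)
  qed
  have XMX: "X *v (M *v (X *v b)) = X *v b" for b
  proof -
    have "P (M *v f b) (f b)"
      using f[of b] by (simp add: P_def)
    then show ?thesis
      using f uniq by (metis X)
  qed
  have sMX: "(M *v (X *v b)) \<bullet> c = b \<bullet> (M *v (X *v c))" for b c
  proof -
    have "(c - M *v f c) \<bullet> (M *v f b) = 0" "(b - M *v f b) \<bullet> (M *v f c) = 0"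
      using f unfolding P_def by blast+
    then show ?thesis
      by (simp add: X inner_diff_left) (metis inner_commute)
  qed
  have sXM: "(X *v (M *v x)) \<bullet> y = x \<bullet> (X *v (M *v y))" for x y
  proof -
    have "M *v (x - f (M *v x)) = 0" for x
      using MXM[of x] by (simp add: X matrix_vector_mult_diff_distrib)
    then have "f (M *v y) \<bullet> (x - f (M *v x)) = 0" "f (M *v x) \<bullet> (y - f (M *v y)) = 0"
      using f unfolding P_def by blast+
    then show ?thesis
      by (simp add: X inner_diff_right) (metis inner_commute)
  qed
  have "moore_penrose M X"
    unfolding moore_penrose_def
  proof (intro conjI)
    show "M ** X ** M = M"
      by (simp add: matrix_eq MXM flip: matrix_vector_mul_assoc)
    show "X ** M ** X = X"
      by (simp add: matrix_eq XMX flip: matrix_vector_mul_assoc)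
    show "transpose (M ** X) = M ** X"
      by (rule symmetric_matrixI) (simp add: sMX flip: matrix_vector_mul_assoc)
    show "transpose (X ** M) = X ** M"
      by (rule symmetric_matrixI) (simp add: sXM flip: matrix_vector_mul_assoc)
  qed
  then show ?thesis ..
qed

lemma ex1_moore_penrose: "\<exists>!X. moore_penrose M X"
  using moore_penrose_exists moore_penrose_unique by blast

lemma moore_penrose_pinv: "moore_penrose M (pinv M)"
  unfolding pinv_def by (rule theI'[OF ex1_moore_penrose])


section \<open>The quadratic problem\<close>

text \<open>The problem is to minimize \<open>x\<^sup>TAx + 2a\<^sup>Tx\<close> subject to \<open>quad B b \<beta> x \<le> 0\<close>.\<close>

definition quad :: "real^'n^'n \<Rightarrow> real^'n \<Rightarrow> real \<Rightarrow> real^'n \<Rightarrow> real" where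
  "quad B b \<beta> x = x \<bullet> (B *v x) + 2 * (b \<bullet> x) + \<beta>"

definition optimal_multiplier ::
  "real^'n^'n \<Rightarrow> real^'n^'n \<Rightarrow> real^'n \<Rightarrow> real^'n \<Rightarrow> real \<Rightarrow> real \<Rightarrow> bool" where
  "optimal_multiplier A B a b \<beta> lam \<longleftrightarrow>
     lam \<ge> 0 \<and>
     (\<exists>x. (A + lam *\<^sub>R B) *v x = - (a + lam *\<^sub>R b) \<and>
          quad B b \<beta> x \<le> 0 \<and> lam * quad B b \<beta> x = 0 \<and>
          pos_semidef (A + lam *\<^sub>R B))"

definition lam_lo :: "real^'n^'n \<Rightarrow> real^'n^'n \<Rightarrow> ereal" where
  "lam_lo A B = Inf (ereal ` {lam. pos_semidef (A + lam *\<^sub>R B)})"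

definition lam_hi :: "real^'n^'n \<Rightarrow> real^'n^'n \<Rightarrow> ereal" where
  "lam_hi A B = Sup (ereal ` {lam. pos_semidef (A + lam *\<^sub>R B)})"

definition x_lam :: "real^'n^'n \<Rightarrow> real^'n^'n \<Rightarrow> real^'n \<Rightarrow> real^'n \<Rightarrow> real \<Rightarrow> real^'n" where
  "x_lam A B a b lam = - (matrix_inv (A + lam *\<^sub>R B) *v (a + lam *\<^sub>R b))"

definition phi ::
  "real^'n^'n \<Rightarrow> real^'n^'n \<Rightarrow> real^'n \<Rightarrow> real^'n \<Rightarrow> real \<Rightarrow> real \<Rightarrow> real" where
  "phi A B a b \<beta> lam = quad B b \<beta> (x_lam A B a b lam)"

definition x_end :: "real^'n^'n \<Rightarrow> real^'n^'n \<Rightarrow> real^'n \<Rightarrow> real^'n \<Rightarrow> real \<Rightarrow> real^'n" where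
  "x_end A B a b lam = - (pinv (A + lam *\<^sub>R B) *v (a + lam *\<^sub>R b))"

text \<open>The infimum and supremum are the interval endpoints: semidefiniteness holds exactly
  between them, and every point of positive definiteness lies strictly inside.\<close>

lemma inner_pencil:
  fixes A B :: "real^'n^'n"
  shows "x \<bullet> ((A + lam *\<^sub>R B) *v x) = x \<bullet> (A *v x) + lam * (x \<bullet> (B *v x))"
  by (simp add: matrix_vector_mult_add_rdistrib inner_add_right flip: scaleR_matrix_vector_assoc)

lemma transpose_pencil:
  fixes A B :: "real^'n^'n"
  assumes "transpose A = A" "transpose B = B"
  shows "transpose (A + lam *\<^sub>R B) = A + lam *\<^sub>R B"
proof -
  have "A $ j $ i = A $ i $ j" "B $ j $ i = B $ i $ j" for i j
    using arg_cong[OF assms(1), of "\<lambda>M. M $ i $ j"] arg_cong[OF assms(2), of "\<lambda>M. M $ i $ j"]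
    by (simp_all add: transpose_def)
  then show ?thesis
    by (simp add: transpose_def vec_eq_iff)
qed

lemma pos_def_imp_pos_semidef: "pos_def M \<Longrightarrow> pos_semidef M"
  unfolding pos_def_def pos_semidef_def by (metis inner_zero_left less_eq_real_def)

lemma pos_semidef_iff_between_endpoints:
  assumes sym: "transpose A = A" "transpose B = B" and pd: "pos_def (A + \<mu> *\<^sub>R B)"
  shows "pos_semidef (A + lam *\<^sub>R B) \<longleftrightarrow> lam_lo A B \<le> ereal lam \<and> ereal lam \<le> lam_hi A B"
proof
  assume "pos_semidef (A + lam *\<^sub>R B)"
  then show "lam_lo A B \<le> ereal lam \<and> ereal lam \<le> lam_hi A B"
    unfolding lam_lo_def lam_hi_def by (simp add: Inf_lower Sup_upper)
next
  assume le: "lam_lo A B \<le> ereal lam \<and> ereal lam \<le> lam_hi A B"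
  have "x \<bullet> ((A + lam *\<^sub>R B) *v x) \<ge> 0" for x
  proof (rule ccontr)
    define c d where "c = x \<bullet> (A *v x)" and "d = x \<bullet> (B *v x)"
    assume "\<not> ?thesis"
    then have neg: "c + lam * d < 0"
      by (simp add: inner_pencil c_def d_def)
    have psd: "c + t * d \<ge> 0" if "pos_semidef (A + t *\<^sub>R B)" for t
      using that unfolding pos_semidef_def inner_pencil c_def d_def by blast
    have "c + \<mu> * d \<ge> 0"
      by (rule psd[OF pos_def_imp_pos_semidef[OF pd]])
    with neg consider "d > 0" | "d < 0"
      by (cases d "0 :: real" rule: linorder_cases) auto
    then show False
    proof cases
      case 1
      have "ereal (- c / d) \<le> lam_lo A B"
        unfolding lam_lo_def
      proof (rule Inf_greatest, clarsimp)
        fix t assume "pos_semidef (A + t *\<^sub>R B)"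
        then show "- (c / d) \<le> t"
          using psd[of t] 1 by (simp add: field_simps)
      qed
      moreover have "lam < - c / d"
        using neg 1 by (simp add: field_simps)
      ultimately show False
        using le by (meson ereal_less_eq(3) not_le order_trans)
    next
      case 2
      have "lam_hi A B \<le> ereal (- c / d)"
        unfolding lam_hi_def
      proof (rule Sup_least, clarsimp)
        fix t assume "pos_semidef (A + t *\<^sub>R B)"
        then show "t \<le> - (c / d)"
          using psd[of t] 2 by (simp add: field_simps)
      qed
      moreover have "- c / d < lam"
        using neg 2 by (simp add: field_simps)
      ultimately show False
        using le by (meson ereal_less_eq(3) not_le order_trans)
    qed
  qed
  then show "pos_semidef (A + lam *\<^sub>R B)"
    by (simp add: pos_semidef_def transpose_pencil[OF sym])
qed

lemma pos_def_strictly_between_endpoints: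
  fixes A B :: "real^'n^'n"
  assumes sym: "transpose A = A" "transpose B = B" and pd: "pos_def (A + \<mu> *\<^sub>R B)"
  shows "lam_lo A B < ereal \<mu>" "ereal \<mu> < lam_hi A B"
proof -
  let ?S = "sphere 0 1 :: (real^'n) set"
  have cont: "continuous_on ?S (\<lambda>x. x \<bullet> (M *v x))" for M :: "real^'n^'n"
    by (intro continuous_on_inner continuous_on_id matrix_vector_mult_linear_continuous_on)
  have ne: "?S \<noteq> {}"
    by simp
  obtain u where u: "u \<in> ?S" and umin: "\<And>x. x \<in> ?S \<Longrightarrow>
      u \<bullet> ((A + \<mu> *\<^sub>R B) *v u) \<le> x \<bullet> ((A + \<mu> *\<^sub>R B) *v x)"
    using continuous_attains_inf[OF compact_sphere ne cont] by blast
  define m where "m = u \<bullet> ((A + \<mu> *\<^sub>R B) *v u)"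
  have m: "m > 0"
    using u pd unfolding m_def pos_def_def by (metis mem_sphere_0 norm_zero zero_neq_one)
  have "compact ((\<lambda>x. x \<bullet> (B *v x)) ` ?S)"
    by (rule compact_continuous_image[OF cont compact_sphere])
  then obtain K where K: "K > 0" "\<And>x. x \<in> ?S \<Longrightarrow> \<bar>x \<bullet> (B *v x)\<bar> \<le> K"
    using compact_imp_bounded bounded_pos by (metis (no_types, lifting) imageI real_norm_def)
  have near: "pos_semidef (A + t *\<^sub>R B)" if t: "\<bar>t - \<mu>\<bar> \<le> m / K" for t
  proof -
    have unit: "x \<bullet> ((A + t *\<^sub>R B) *v x) \<ge> 0" if "x \<in> ?S" for x
    proof -
      have "\<bar>(t - \<mu>) * (x \<bullet> (B *v x))\<bar> \<le> m / K * K"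
        unfolding abs_mult using K that t m by (intro mult_mono) auto
      then have "- m \<le> (t - \<mu>) * (x \<bullet> (B *v x))"
        using K(1) by auto
      moreover have "m \<le> x \<bullet> ((A + \<mu> *\<^sub>R B) *v x)"
        using umin[OF that] by (simp add: m_def)
      ultimately show ?thesis
        unfolding inner_pencil left_diff_distrib by linarith
    qed
    have "x \<bullet> ((A + t *\<^sub>R B) *v x) \<ge> 0" for x
    proof (cases "x = 0")
      case False
      define y where "y = x /\<^sub>R norm x"
      have "y \<in> ?S" and x: "x = norm x *\<^sub>R y"
        using False by (simp_all add: y_def)
      then have "y \<bullet> ((A + t *\<^sub>R B) *v y) \<ge> 0"
        using unit by blast
      moreover have "x \<bullet> ((A + t *\<^sub>R B) *v x) = norm x * (norm x * (y \<bullet> ((A + t *\<^sub>R B) *v y)))"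
        by (subst (1 2) x) (simp add: matrix_vector_mult_scaleR)
      ultimately show ?thesis
        by simp
    qed simp
    then show ?thesis
      by (simp add: pos_semidef_def transpose_pencil[OF sym])
  qed
  have "pos_semidef (A + (\<mu> - m / K) *\<^sub>R B)" "pos_semidef (A + (\<mu> + m / K) *\<^sub>R B)"
    using m K by (auto intro!: near)
  then have "lam_lo A B \<le> ereal (\<mu> - m / K)" "ereal (\<mu> + m / K) \<le> lam_hi A B"
    unfolding lam_lo_def lam_hi_def by (auto intro!: Inf_lower Sup_upper)
  moreover have "ereal (\<mu> - m / K) < ereal \<mu>" "ereal \<mu> < ereal (\<mu> + m / K)"
    using m K by simp_all
  ultimately show "lam_lo A B < ereal \<mu>" "ereal \<mu> < lam_hi A B"
    by (meson le_less_trans less_le_trans)+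
qed


section \<open>Orthonormal bases and extrema over the null space\<close>

definition range_space :: "real^'m^'n \<Rightarrow> (real^'n) set" where
  "range_space M = range ((*v) M)"

definition null_space :: "real^'m^'n \<Rightarrow> (real^'m) set" where
  "null_space M = {x. M *v x = 0}"

definition orthonormal_basis :: "nat \<Rightarrow> (nat \<Rightarrow> real^'n) \<Rightarrow> (real^'n) set \<Rightarrow> bool" where
  "orthonormal_basis r v S \<longleftrightarrow>
     (\<forall>i\<in>{1..r}. \<forall>j\<in>{1..r}. v i \<bullet> v j = (if i = j then 1 else 0)) \<and>
     span (v ` {1..r}) = S"

text \<open>Here \<open>r\<close> depends on the data, so \<open>\<real>\<^sup>r\<close> is the set \<open>{1..r} \<rightarrow>\<^sub>E UNIV\<close>, and
  \<open>Zy\<close> is written out as the combination of the columns of \<open>Z = [v\<^sub>1,\<dots>,v\<^sub>r]\<close>.\<close>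

definition values_on_affine ::
  "(real^'n \<Rightarrow> real) \<Rightarrow> real^'n \<Rightarrow> nat \<Rightarrow> (nat \<Rightarrow> real^'n) \<Rightarrow> real set" where
  "values_on_affine g x0 r v =
     (\<lambda>y. g (x0 + (\<Sum>i=1..r. y i *\<^sub>R v i))) ` ({1..r} \<rightarrow>\<^sub>E UNIV)"

definition is_maximum :: "real \<Rightarrow> real set \<Rightarrow> bool" where
  "is_maximum p S \<longleftrightarrow> p \<in> S \<and> (\<forall>s\<in>S. s \<le> p)"

definition is_minimum :: "real \<Rightarrow> real set \<Rightarrow> bool" where
  "is_minimum p S \<longleftrightarrow> p \<in> S \<and> (\<forall>s\<in>S. p \<le> s)"

end

theory Submission
  imports Defs
begin

text \<open>
  Write \<open>L\<^sub>\<lambda> = q + \<lambda> g\<close> for the Lagrangian, whose stationary points solve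
  \<open>(A + \<lambda> B) x = - (a + \<lambda> b)\<close>. At an endpoint \<open>e\<close> of the semidefiniteness interval the
  stationary points form the affine space \<open>x(e) + Null (A + e B)\<close>, on which \<open>g\<close> is strictly
  concave (upper end) or strictly convex (lower end): a null vector \<open>z\<close> of \<open>A + e B\<close> makes
  \<open>z \<bullet> A z + \<lambda> (z \<bullet> B z)\<close> vanish at \<open>\<lambda> = e\<close> while it is positive at the interior point
  \<open>lam_hat\<close>, so the sign of \<open>z \<bullet> B z\<close> is forced. Hence the extremum \<open>p\<close> exists.

  If the multiplier is the endpoint, its primal solution lies in this affine space and
  complementarity gives the sign of \<open>p\<close>. Conversely, suppose \<open>p\<close> has that sign, at a point
  \<open>y\<close>, but the multiplier \<open>l\<close> is not the endpoint. Then \<open>A + l B\<close> is positive definite and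
  \<open>l > 0\<close>, so the primal solution \<open>x\<close> has \<open>g x = 0\<close>. Comparing \<open>L\<^sub>l\<close> and \<open>L\<^sub>e\<close> at \<open>x\<close> and \<open>y\<close>
  (\<open>stationary_points_compare\<close>: \<open>g\<close> is monotone along stationary points) forces \<open>x = y\<close>.
  A point that is stationary for two multipliers is stationary for all of them, so it equals
  \<open>x(lam_hat)\<close> and \<open>phi lam_hat = 0\<close>, contrary to hypothesis.

  The lower endpoint is the upper one for the constraint data \<open>- B, - b, - \<beta>\<close> and the
  parameter \<open>- \<lambda>\<close>, which leave \<open>A + \<lambda> B\<close> and \<open>a + \<lambda> b\<close> unchanged. The common argument
  \<open>upper_end_iff_maximum_nonneg\<close> is therefore stated without sign conditions on the parameters.
\<close>

section \<open>Quadratic functions and their stationary points\<close>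

lemma transpose_eq_imp_inner:
  fixes M :: "real^'n^'n"
  assumes "transpose M = M"
  shows "x \<bullet> (M *v y) = y \<bullet> (M *v x)"
  by (metis assms inner_transpose_matrix inner_commute)

lemma quad_uminus: "quad (- B) (- b) (- \<beta>) x = - quad B b \<beta> x"
proof -
  have "(- B) *v x = - (B *v x)"
    using scaleR_matrix_vector_assoc[of "-1" B x] by simp
  then show ?thesis
    by (simp add: quad_def)
qed

lemma quad_pencil:
  "quad (A + l *\<^sub>R B) (a + l *\<^sub>R b) (\<alpha> + l * \<beta>) x = quad A a \<alpha> x + l * quad B b \<beta> x"
  unfolding quad_def inner_pencil by (simp add: inner_add_left algebra_simps)

lemma quad_add:
  assumes "transpose M = M"
  shows "quad M c \<gamma> (x + d) = quad M c \<gamma> x + 2 * ((M *v x + c) \<bullet> d) + d \<bullet> (M *v d)"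
  using transpose_eq_imp_inner[OF assms, of x d]
  by (simp add: quad_def matrix_vector_right_distrib inner_add_left inner_add_right algebra_simps
      inner_commute[of "M *v x"])

lemma quad_stationary:
  assumes "transpose M = M" "M *v x = - c"
  shows "quad M c \<gamma> y = quad M c \<gamma> x + (y - x) \<bullet> (M *v (y - x))"
  using quad_add[OF assms(1), of c \<gamma> x "y - x"] assms(2) by simp

text \<open>Expanding the Lagrangian with parameter \<open>l\<close> about its stationary point \<open>x\<close>, and the one
  with parameter \<open>e\<close> about \<open>y\<close>, and adding: the objective cancels.\<close>

lemma stationary_points_compare:
  fixes A B :: "real^'n^'n"
  assumes sym: "transpose A = A" "transpose B = B"
    and x: "(A + l *\<^sub>R B) *v x = - (a + l *\<^sub>R b)"
    and y: "(A + e *\<^sub>R B) *v y = - (a + e *\<^sub>R b)"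
  shows "(e - l) * (quad B b \<beta> x - quad B b \<beta> y) =
    (y - x) \<bullet> ((A + l *\<^sub>R B) *v (y - x)) + (x - y) \<bullet> ((A + e *\<^sub>R B) *v (x - y))"
  using quad_stationary[OF transpose_pencil[OF sym] x, of "0 + l * \<beta>" y]
    quad_stationary[OF transpose_pencil[OF sym] y, of "0 + e * \<beta>" x]
  unfolding quad_pencil by (simp add: algebra_simps)

lemma stationary_for_two_imp_all:
  fixes A B :: "real^'n^'n"
  assumes l: "(A + l *\<^sub>R B) *v x = - (a + l *\<^sub>R b)"
    and e: "(A + e *\<^sub>R B) *v x = - (a + e *\<^sub>R b)" and "l \<noteq> e"
  shows "(A + m *\<^sub>R B) *v x = - (a + m *\<^sub>R b)"
proof -
  have pencil: "(A + t *\<^sub>R B) *v x = A *v x + t *\<^sub>R (B *v x)" for t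
    by (simp add: matrix_vector_mult_add_rdistrib scaleR_matrix_vector_assoc)
  have 1: "A *v x + a + l *\<^sub>R (B *v x + b) = 0" and 2: "A *v x + a + e *\<^sub>R (B *v x + b) = 0"
    using l e unfolding pencil by (simp_all add: algebra_simps eq_neg_iff_add_eq_0)
  have "(l - e) *\<^sub>R (B *v x + b) = (A *v x + a + l *\<^sub>R (B *v x + b)) - (A *v x + a + e *\<^sub>R (B *v x + b))"
    by (simp add: algebra_simps)
  then have B0: "B *v x + b = 0"
    unfolding 1 2 using \<open>l \<noteq> e\<close> by simp
  with 1 have "A *v x + a = 0"
    by simp
  with B0 show ?thesis
    unfolding pencil by (simp add: eq_neg_iff_add_eq_0[symmetric])
qed

lemma pos_def_mult_cancel:
  assumes "pos_def M" "M *v x = M *v y"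
  shows "x = y"
proof (rule ccontr)
  assume "x \<noteq> y"
  then have "(x - y) \<bullet> (M *v (x - y)) > 0"
    using assms(1) unfolding pos_def_def by simp
  then show False
    using assms(2) by (simp add: matrix_vector_mult_diff_distrib)
qed

lemma pos_def_imp_invertible:
  assumes "pos_def M"
  shows "invertible M"
  using pos_def_mult_cancel[OF assms] matrix_left_invertible_injective[of M]
  by (metis injI invertible_left_inverse)

text \<open>For fixed \<open>x\<close> the form \<open>x \<bullet> (A + l B) x\<close> is affine in \<open>l\<close>, hence at \<open>l\<close> a convex
  combination, with positive weight at \<open>m\<close>, of its values at \<open>m\<close> and \<open>e\<close>.\<close>

lemma pos_def_strictly_between:
  fixes A B :: "real^'n^'n"
  assumes sym: "transpose A = A" "transpose B = B"
    and pd: "pos_def (A + m *\<^sub>R B)" and psd: "pos_semidef (A + e *\<^sub>R B)"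
    and "m < l" "l < e"
  shows "pos_def (A + l *\<^sub>R B)"
  unfolding pos_def_def
proof (intro conjI allI impI)
  show "transpose (A + l *\<^sub>R B) = A + l *\<^sub>R B"
    by (rule transpose_pencil[OF sym])
  fix x :: "real^'n"
  assume "x \<noteq> 0"
  define c d where "c = x \<bullet> (A *v x)" and "d = x \<bullet> (B *v x)"
  have "c + m * d > 0" "c + e * d \<ge> 0"
    using pd psd \<open>x \<noteq> 0\<close> unfolding pos_def_def pos_semidef_def c_def d_def
    by (simp_all flip: inner_pencil)
  then have "(e - l) * (c + m * d) + (l - m) * (c + e * d) > 0"
    using \<open>m < l\<close> \<open>l < e\<close> by (meson add_pos_nonneg mult_pos_pos mult_nonneg_nonneg diff_gt_0_iff_gt less_imp_le)
  then have "(e - m) * (c + l * d) > 0"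
    by (simp add: algebra_simps)
  then have "c + l * d > 0"
    using \<open>m < l\<close> \<open>l < e\<close> by (simp add: zero_less_mult_iff)
  then show "x \<bullet> ((A + l *\<^sub>R B) *v x) > 0"
    unfolding inner_pencil c_def d_def .
qed

section \<open>Attainment of the maximum on an affine space\<close>

text \<open>Negative definiteness on the unit sphere of the subspace gives
  \<open>quad B b \<beta> (x0 + z) - quad B b \<beta> x0 \<le> norm z * (2 * norm (B x0 + b) - m * norm z)\<close>, so points
  outside a ball around \<open>x0\<close> do not beat \<open>x0\<close> and a compact set carries the maximum.\<close>

lemma quad_attains_max_on_affine:
  fixes B :: "real^'n^'n"
  assumes sym: "transpose B = B" and S: "subspace S"
    and neg: "\<And>z. z \<in> S \<Longrightarrow> z \<noteq> 0 \<Longrightarrow> z \<bullet> (B *v z) < 0"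
  shows "\<exists>z\<in>S. \<forall>w\<in>S. quad B b \<beta> (x0 + w) \<le> quad B b \<beta> (x0 + z)"
proof -
  have cont: "continuous_on T (\<lambda>x. x \<bullet> (B *v x))" for T
    by (intro continuous_on_inner continuous_on_id matrix_vector_mult_linear_continuous_on)
  have "\<exists>m>0. \<forall>z\<in>S. norm z = 1 \<longrightarrow> z \<bullet> (B *v z) \<le> - m"
  proof (cases "S \<inter> sphere 0 1 = {}")
    case True
    then show ?thesis
      by (intro exI[of _ 1]) auto
  next
    case False
    have "compact (S \<inter> sphere 0 1)"
      using closed_subspace[OF S] by (simp add: closed_Int_compact)
    then obtain u where u: "u \<in> S" "norm u = 1"
      and umax: "\<forall>z\<in>S \<inter> sphere 0 1. z \<bullet> (B *v z) \<le> u \<bullet> (B *v u)"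
      using continuous_attains_sup[OF _ False cont] by auto
    have "u \<noteq> 0"
      using u by auto
    then show ?thesis
      using u umax neg[of u] by (intro exI[of _ "- (u \<bullet> (B *v u))"]) auto
  qed
  then obtain m where m: "m > 0" "\<And>z. z \<in> S \<Longrightarrow> norm z = 1 \<Longrightarrow> z \<bullet> (B *v z) \<le> - m"
    by blast
  have form: "z \<bullet> (B *v z) \<le> - m * (norm z)\<^sup>2" if "z \<in> S" for z
  proof (cases "z = 0")
    case False
    define w where "w = z /\<^sub>R norm z"
    have z: "z = norm z *\<^sub>R w" and "norm w = 1" "w \<in> S"
      using False that S by (simp_all add: w_def subspace_scale)
    then have "w \<bullet> (B *v w) \<le> - m"
      using m by blast
    then have "(norm z)\<^sup>2 * (w \<bullet> (B *v w)) \<le> (norm z)\<^sup>2 * (- m)"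
      by (intro mult_left_mono) auto
    moreover have "z \<bullet> (B *v z) = (norm z)\<^sup>2 * (w \<bullet> (B *v w))"
      by (subst (1 2) z) (simp add: matrix_vector_mult_scaleR power2_eq_square)
    ultimately show ?thesis
      by (simp add: mult.commute)
  qed simp
  define c where "c = B *v x0 + b"
  define R where "R = 2 * norm c / m"
  have R: "R \<ge> 0"
    using m by (simp add: R_def)
  have far: "quad B b \<beta> (x0 + w) \<le> quad B b \<beta> x0" if "w \<in> S" "norm w > R" for w
  proof -
    have "2 * norm c \<le> m * norm w"
      using that m by (simp add: R_def field_simps)
    then have "norm w * (2 * norm c) \<le> norm w * (m * norm w)"
      by (intro mult_left_mono) auto
    moreover have "c \<bullet> w \<le> norm c * norm w"
      by (rule norm_cauchy_schwarz)
    ultimately show ?thesis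
      using form[OF that(1)] unfolding quad_add[OF sym] c_def[symmetric]
      by (simp add: power2_eq_square algebra_simps)
  qed
  have "continuous_on (S \<inter> cball 0 R) (\<lambda>z. quad B b \<beta> (x0 + z))"
    unfolding quad_def
    by (intro continuous_intros
        continuous_on_compose2[OF linear_continuous_on[OF matrix_vector_mul_bounded_linear]]) auto
  moreover have "compact (S \<inter> cball 0 R)" "0 \<in> S \<inter> cball 0 R"
    using closed_subspace[OF S] subspace_0[OF S] R by (simp_all add: closed_Int_compact)
  ultimately obtain z where z: "z \<in> S"
    and zmax: "\<And>w. w \<in> S \<inter> cball 0 R \<Longrightarrow> quad B b \<beta> (x0 + w) \<le> quad B b \<beta> (x0 + z)"
    using continuous_attains_sup[of "S \<inter> cball 0 R"] by (metis (no_types, lifting) IntD1 empty_iff)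
  have "quad B b \<beta> (x0 + w) \<le> quad B b \<beta> (x0 + z)" if "w \<in> S" for w
  proof (cases "norm w \<le> R")
    case True
    then show ?thesis
      using zmax that by simp
  next
    case False
    have "quad B b \<beta> (x0 + w) \<le> quad B b \<beta> (x0 + 0)"
      using far[OF that] False by simp
    also have "\<dots> \<le> quad B b \<beta> (x0 + z)"
      using zmax \<open>0 \<in> S \<inter> cball 0 R\<close> by blast
    finally show ?thesis .
  qed
  then show ?thesis
    using z by blast
qed

lemma orthonormal_basis_expansion:
  assumes "orthonormal_basis r v S" "z \<in> S"
  shows "z = (\<Sum>i=1..r. (z \<bullet> v i) *\<^sub>R v i)"
proof -
  have on: "v j \<bullet> v i = (if j = i then 1 else 0)" if "j \<in> {1..r}" "i \<in> {1..r}" for i j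
    using assms(1) that unfolding orthonormal_basis_def by blast
  have "z \<in> span (v ` {1..r})"
    using assms unfolding orthonormal_basis_def by blast
  moreover have "subspace {z. z = (\<Sum>i=1..r. (z \<bullet> v i) *\<^sub>R v i)}"
    by (auto simp: subspace_def inner_add_left scaleR_add_left sum.distrib)
      (metis (no_types, lifting) scaleR_sum_right scaleR_scaleR sum.cong)
  moreover have "v j = (\<Sum>i=1..r. (v j \<bullet> v i) *\<^sub>R v i)" if "j \<in> {1..r}" for j
  proof -
    have "(\<Sum>i=1..r. (v j \<bullet> v i) *\<^sub>R v i) = (\<Sum>i=1..r. if j = i then v i else 0)"
      by (intro sum.cong refl) (use on[OF that] in simp)
    then show ?thesis
      using that by simp
  qed
  ultimately show ?thesis
    using span_minimal[of "v ` {1..r}" "{z. z = (\<Sum>i=1..r. (z \<bullet> v i) *\<^sub>R v i)}"] by blast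
qed

lemma values_on_affine_eq:
  assumes "orthonormal_basis r v S"
  shows "values_on_affine g x0 r v = (\<lambda>z. g (x0 + z)) ` S"
proof
  have S: "span (v ` {1..r}) = S"
    using assms unfolding orthonormal_basis_def by blast
  have "(\<Sum>i=1..r. y i *\<^sub>R v i) \<in> S" for y
    unfolding S[symmetric] by (intro span_sum span_scale span_base) simp
  then show "values_on_affine g x0 r v \<subseteq> (\<lambda>z. g (x0 + z)) ` S"
    unfolding values_on_affine_def by blast
  show "(\<lambda>z. g (x0 + z)) ` S \<subseteq> values_on_affine g x0 r v"
  proof (rule image_subsetI)
    fix z assume "z \<in> S"
    define y where "y = (\<lambda>i\<in>{1..r}. z \<bullet> v i)"
    have "(\<Sum>i=1..r. y i *\<^sub>R v i) = (\<Sum>i=1..r. (z \<bullet> v i) *\<^sub>R v i)"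
      by (intro sum.cong refl) (simp add: y_def)
    then have "z = (\<Sum>i=1..r. y i *\<^sub>R v i)"
      using orthonormal_basis_expansion[OF assms \<open>z \<in> S\<close>] by simp
    moreover have "y \<in> {1..r} \<rightarrow>\<^sub>E UNIV"
      by (simp add: y_def)
    ultimately show "g (x0 + z) \<in> values_on_affine g x0 r v"
      unfolding values_on_affine_def by blast
  qed
qed

lemma is_maximum_uminus_values:
  assumes "is_maximum p (values_on_affine (\<lambda>x. - g x) x0 r v)"
  shows "is_minimum (- p) (values_on_affine g x0 r v)"
  using assms unfolding is_maximum_def is_minimum_def values_on_affine_def by force

section \<open>The two endpoints\<close>

lemma x_lam_stationary:
  assumes "pos_def (A + l *\<^sub>R B)"
  shows "(A + l *\<^sub>R B) *v x_lam A B a b l = - (a + l *\<^sub>R b)"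
proof -
  define M where "M = A + l *\<^sub>R B"
  have "M ** matrix_inv M = mat 1"
    using pos_def_imp_invertible[OF assms] unfolding M_def[symmetric] invertible_def matrix_inv_def
    by (rule someI2_ex) blast
  then have "M *v (matrix_inv M *v c) = c" for c
    by (simp add: matrix_vector_mul_assoc)
  then show ?thesis
    by (simp add: x_lam_def vec.neg flip: M_def)
qed

lemma x_end_stationary:
  assumes "a + e *\<^sub>R b \<in> range_space (A + e *\<^sub>R B)"
  shows "(A + e *\<^sub>R B) *v x_end A B a b e = - (a + e *\<^sub>R b)"
proof -
  define M where "M = A + e *\<^sub>R B"
  obtain w where w: "a + e *\<^sub>R b = M *v w"
    using assms unfolding range_space_def M_def by blast
  have "M ** pinv M ** M = M"
    using moore_penrose_pinv[of M] unfolding moore_penrose_def by blast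
  then have "M *v (pinv M *v (M *v w)) = M *v w"
    by (simp add: matrix_vector_mul_assoc matrix_mul_assoc)
  then show ?thesis
    unfolding x_end_def M_def[symmetric] w by (simp add: vec.neg)
qed

text \<open>The two conditions on \<open>quad B b \<beta> x\<close> are the form of complementary slackness that survives
  the reflection \<open>\<lambda> \<mapsto> - \<lambda>\<close>: they cover a lower endpoint equal to \<open>0\<close>, where the constraint may
  be slack. The hypothesis \<open>quad B b \<beta> xm \<noteq> 0\<close> excludes that a point with
  \<open>quad B b \<beta> x = 0\<close> is stationary for every parameter.\<close>

lemma upper_end_iff_maximum_nonneg:
  fixes A B :: "real^'n^'n"
  assumes sym: "transpose A = A" "transpose B = B"
    and pd: "pos_def (A + m *\<^sub>R B)" and psd: "pos_semidef (A + e *\<^sub>R B)"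
    and "m < l" "l \<le> e"
    and xm: "(A + m *\<^sub>R B) *v xm = - (a + m *\<^sub>R b)" and xm0: "quad B b \<beta> xm \<noteq> 0"
    and x: "(A + l *\<^sub>R B) *v x = - (a + l *\<^sub>R b)"
    and x_less: "l < e \<Longrightarrow> quad B b \<beta> x = 0" and x_eq: "l = e \<Longrightarrow> quad B b \<beta> x \<ge> 0"
    and xe: "(A + e *\<^sub>R B) *v xe = - (a + e *\<^sub>R b)"
    and basis: "orthonormal_basis r v (null_space (A + e *\<^sub>R B))"
  shows "\<exists>p. is_maximum p (values_on_affine (quad B b \<beta>) xe r v) \<and> (l = e \<longleftrightarrow> p \<ge> 0)"
proof -
  let ?N = "null_space (A + e *\<^sub>R B)"
  have N: "subspace ?N"
    by (auto simp: null_space_def subspace_def matrix_vector_right_distrib matrix_vector_mult_scaleR)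
  have "z \<bullet> (B *v z) < 0" if "z \<in> ?N" "z \<noteq> 0" for z
  proof -
    have "z \<bullet> ((A + m *\<^sub>R B) *v z) > 0" "z \<bullet> ((A + e *\<^sub>R B) *v z) = 0"
      using that pd by (simp_all add: null_space_def pos_def_def)
    then have "(e - m) * (z \<bullet> (B *v z)) < 0"
      unfolding inner_pencil by (simp add: algebra_simps)
    then show ?thesis
      using \<open>m < l\<close> \<open>l \<le> e\<close> by (simp add: mult_less_0_iff)
  qed
  then obtain z where z: "z \<in> ?N"
    and zmax: "\<And>w. w \<in> ?N \<Longrightarrow> quad B b \<beta> (xe + w) \<le> quad B b \<beta> (xe + z)"
    using quad_attains_max_on_affine[OF sym(2) N] by metis
  define y where "y = xe + z"
  have y: "(A + e *\<^sub>R B) *v y = - (a + e *\<^sub>R b)"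
    using xe z by (simp add: y_def null_space_def matrix_vector_right_distrib)
  have "is_maximum (quad B b \<beta> y) (values_on_affine (quad B b \<beta>) xe r v)"
    using z zmax unfolding values_on_affine_eq[OF basis] is_maximum_def y_def by blast
  moreover have "quad B b \<beta> y \<ge> 0" if "l = e"
  proof -
    have "x - xe \<in> ?N"
      using x xe that by (simp add: null_space_def matrix_vector_mult_diff_distrib)
    then have "quad B b \<beta> x \<le> quad B b \<beta> y"
      using zmax[of "x - xe"] by (simp add: y_def)
    then show ?thesis
      using x_eq[OF that] by simp
  qed
  moreover have "l = e" if nonneg: "quad B b \<beta> y \<ge> 0"
  proof (rule ccontr)
    assume "l \<noteq> e"
    then have "l < e"
      using \<open>l \<le> e\<close> by simp
    have pdl: "pos_def (A + l *\<^sub>R B)"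
      by (rule pos_def_strictly_between[OF sym pd psd \<open>m < l\<close> \<open>l < e\<close>])
    have "(e - l) * (quad B b \<beta> x - quad B b \<beta> y) \<le> 0"
      using x_less[OF \<open>l < e\<close>] nonneg \<open>l < e\<close> by (simp add: mult_le_0_iff)
    moreover have "(x - y) \<bullet> ((A + e *\<^sub>R B) *v (x - y)) \<ge> 0"
      using psd unfolding pos_semidef_def by blast
    ultimately have "(y - x) \<bullet> ((A + l *\<^sub>R B) *v (y - x)) \<le> 0"
      unfolding stationary_points_compare[OF sym x y] by simp
    then have "y - x = 0"
      using pdl unfolding pos_def_def by (meson not_less)
    then have "(A + e *\<^sub>R B) *v x = - (a + e *\<^sub>R b)"
      using y by simp
    then have "(A + m *\<^sub>R B) *v x = (A + m *\<^sub>R B) *v xm"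
      using stationary_for_two_imp_all[OF x _ \<open>l \<noteq> e\<close>] xm by simp
    then have "x = xm"
      by (rule pos_def_mult_cancel[OF pd])
    then show False
      using xm0 x_less[OF \<open>l < e\<close>] by simp
  qed
  ultimately show ?thesis
    by blast
qed

theorem mainTheorem1:
  fixes A B :: "real^'n^'n" and a b :: "real^'n" and \<beta> lam_hat lam_star :: real
  assumes "transpose A = A" and "transpose B = B"
    and "\<exists>x. quad B b \<beta> x < 0"
    and "lam_hat \<ge> 0" and "pos_def (A + lam_hat *\<^sub>R B)"
    and "optimal_multiplier A B a b \<beta> lam_star"
  shows
    "(\<forall>(hi::real) (r::nat) v.
        phi A B a b \<beta> lam_hat > 0 \<and>
        lam_hat < lam_star \<and> ereal lam_star \<le> lam_hi A B \<and>
        lam_hi A B = ereal hi \<and>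
        a + hi *\<^sub>R b \<in> range_space (A + hi *\<^sub>R B) \<and>
        orthonormal_basis r v (null_space (A + hi *\<^sub>R B))
        \<longrightarrow> (\<exists>p. is_maximum p (values_on_affine (quad B b \<beta>) (x_end A B a b hi) r v) \<and>
                 (lam_star = hi \<longleftrightarrow> p \<ge> 0)))
     \<and>
     (\<forall>(lo::real) (r::nat) v.
        phi A B a b \<beta> lam_hat < 0 \<and>
        lam_lo A B \<le> ereal lam_star \<and> lam_star < lam_hat \<and>
        lam_lo A B = ereal lo \<and> lo \<ge> 0 \<and>
        a + lo *\<^sub>R b \<in> range_space (A + lo *\<^sub>R B) \<and>
        orthonormal_basis r v (null_space (A + lo *\<^sub>R B))
        \<longrightarrow> (\<exists>p. is_minimum p (values_on_affine (quad B b \<beta>) (x_end A B a b lo) r v) \<and>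
                 (lam_star = lo \<longleftrightarrow> p \<le> 0)))"
proof -
  note sym = assms(1,2) and pd = assms(5)
  obtain x where "lam_star \<ge> 0" and x: "(A + lam_star *\<^sub>R B) *v x = - (a + lam_star *\<^sub>R b)"
    and feas: "quad B b \<beta> x \<le> 0" and compl: "lam_star * quad B b \<beta> x = 0"
    using assms(6) unfolding optimal_multiplier_def by blast
  note xm = x_lam_stationary[OF pd, of a b]
  note inside = pos_def_strictly_between_endpoints[OF sym pd]
  have "\<exists>p. is_maximum p (values_on_affine (quad B b \<beta>) (x_end A B a b hi) r v) \<and>
      (lam_star = hi \<longleftrightarrow> p \<ge> 0)"
    if phi: "phi A B a b \<beta> lam_hat > 0" and less: "lam_hat < lam_star"
      and le: "ereal lam_star \<le> lam_hi A B" and hi: "lam_hi A B = ereal hi"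
      and range: "a + hi *\<^sub>R b \<in> range_space (A + hi *\<^sub>R B)"
      and basis: "orthonormal_basis r v (null_space (A + hi *\<^sub>R B))" for hi r v
  proof -
    have "pos_semidef (A + hi *\<^sub>R B)"
      unfolding pos_semidef_iff_between_endpoints[OF sym pd]
      using inside hi by (metis less_imp_le less_trans order_refl)
    moreover have "quad B b \<beta> x = 0"
      using compl less \<open>lam_hat \<ge> 0\<close> by simp
    ultimately show ?thesis
      using le hi phi
      by (intro upper_end_iff_maximum_nonneg[OF sym pd _ less _ xm _ x _ _
            x_end_stationary[OF range] basis])
        (simp_all add: phi_def)
  qed
  moreover have "\<exists>p. is_minimum p (values_on_affine (quad B b \<beta>) (x_end A B a b lo) r v) \<and>
      (lam_star = lo \<longleftrightarrow> p \<le> 0)"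
    if phi: "phi A B a b \<beta> lam_hat < 0" and le: "lam_lo A B \<le> ereal lam_star"
      and less: "lam_star < lam_hat" and lo: "lam_lo A B = ereal lo" and "lo \<ge> 0"
      and range: "a + lo *\<^sub>R b \<in> range_space (A + lo *\<^sub>R B)"
      and basis: "orthonormal_basis r v (null_space (A + lo *\<^sub>R B))" for lo r v
  proof -
    have psd: "pos_semidef (A + lo *\<^sub>R B)"
      unfolding pos_semidef_iff_between_endpoints[OF sym pd]
      using inside lo by (metis less_imp_le less_trans order_refl)
    have symB: "transpose (- B) = - B"
      using transpose_pencil[OF _ sym(2), of "0" "-1"] by (simp add: transpose_def vec_eq_iff)
    have x0: "quad B b \<beta> x = 0" if "- lam_star < - lo"
      using compl that \<open>lo \<ge> 0\<close> by simp
    have "\<exists>p. is_maximum p (values_on_affine (quad (- B) (- b) (- \<beta>)) (x_end A B a b lo) r v) \<and>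
        (- lam_star = - lo \<longleftrightarrow> p \<ge> 0)"
      by (rule upper_end_iff_maximum_nonneg[where A = A and B = "- B" and a = a and b = "- b"
            and \<beta> = "- \<beta>" and m = "- lam_hat" and x = x and xm = "x_lam A B a b lam_hat"])
        (use sym symB pd psd less le lo xm phi x x0 feas basis x_end_stationary[OF range]
          in \<open>simp_all add: quad_uminus phi_def\<close>)
    then obtain p where "is_maximum p (values_on_affine (\<lambda>x. - quad B b \<beta> x) (x_end A B a b lo) r v)"
      and "lam_star = lo \<longleftrightarrow> p \<ge> 0"
      unfolding quad_uminus[abs_def] by auto
    then show ?thesis
      by (intro exI[of _ "- p"]) (simp add: is_maximum_uminus_values)
  qed
  ultimately show ?thesis
    by blast
qed

end
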